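(* Let $X$ be an implicative-orthomodular lattice. The following are equivalent: (a) $X$ is an implicative-Boolean algebra; (b) $x\wedge_Q y\le_L x$ for all $x,y\in X$; (c) $x\le_L x\vee_Q y$ for all $x,y\in X$.
   Context: A BE algebra is an algebra $(X,\to,1)$ such that for all $x,y,z\in X$: $x\to x=1$; $x\to 1=1$; $1\to x=x$; $x\to(y\to z)=y\to(x\to z)$. It carries the relation $x\le y$ iff $x\to y=1$. It is bounded if there is $0\in X$ with $0\le x$ for all $x\in X$; then $x^*:=x\to 0$ (so $0=1^*$) and the algebra is written $(X,\to,{}^*,1)$. It is involutive if $x^{**}=x$ for all $x$, and implicative if $(x\to y)\to x=x$ for all $x,y$. An implicative-ortholattice is an implicative involutive (bounded) BE algebra. Put $x\vee_Q y:=(x\to y)\to y$, $x\wedge_Q y:=((x^*\to y^* )\to y^* )^*$, and $x\le_L y$ iff $x=(x\to y^* )^*$. An implicative-orthomodular lattice is an implicative-ortholattice with $x\wedge_Q(y\to x)=x$ for all $x,y$. An implicative-Boolean algebra is an implicative-ortholattice with $(y^*\to x)\to y=x\to y$ for all $x,y$. *)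

theory Defs
  imports Main
begin

text \<open>
  Algebras are given by an explicit carrier \<open>X\<close> inside an ambient type; the operation is only
  constrained on \<open>X\<close>.
\<close>

locale BE_algebra =
  fixes X :: "'a set"
    and imp :: "'a \<Rightarrow> 'a \<Rightarrow> 'a"  (infixr "\<leadsto>" 65)
    and one :: 'a  ("\<one>")
  assumes imp_closed: "\<lbrakk>x \<in> X; y \<in> X\<rbrakk> \<Longrightarrow> x \<leadsto> y \<in> X"
    and one_closed: "\<one> \<in> X"
    and imp_self: "x \<in> X \<Longrightarrow> x \<leadsto> x = \<one>"
    and imp_one: "x \<in> X \<Longrightarrow> x \<leadsto> \<one> = \<one>"
    and one_imp: "x \<in> X \<Longrightarrow> \<one> \<leadsto> x = x"
    and exchange: "\<lbrakk>x \<in> X; y \<in> X; z \<in> X\<rbrakk> \<Longrightarrow> x \<leadsto> (y \<leadsto> z) = y \<leadsto> (x \<leadsto> z)"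
begin

definition le :: "'a \<Rightarrow> 'a \<Rightarrow> bool"  (infix "\<preceq>" 50)
  where "x \<preceq> y \<longleftrightarrow> x \<leadsto> y = \<one>"

end

locale bounded_BE_algebra = BE_algebra +
  fixes zero :: 'a  ("\<zero>")
  assumes zero_closed: "\<zero> \<in> X"
    and zero_le: "x \<in> X \<Longrightarrow> \<zero> \<preceq> x"
begin

definition star :: "'a \<Rightarrow> 'a"  ("_\<^sup>\<star>" [999] 999)
  where "x\<^sup>\<star> = x \<leadsto> \<zero>"

definition join_Q :: "'a \<Rightarrow> 'a \<Rightarrow> 'a"  (infixl "\<squnion>\<^sub>Q" 70)
  where "x \<squnion>\<^sub>Q y = (x \<leadsto> y) \<leadsto> y"

definition meet_Q :: "'a \<Rightarrow> 'a \<Rightarrow> 'a"  (infixl "\<sqinter>\<^sub>Q" 70)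
  where "x \<sqinter>\<^sub>Q y = ((x\<^sup>\<star> \<leadsto> y\<^sup>\<star>) \<leadsto> y\<^sup>\<star>)\<^sup>\<star>"

definition le_L :: "'a \<Rightarrow> 'a \<Rightarrow> bool"  (infix "\<preceq>\<^sub>L" 50)
  where "x \<preceq>\<^sub>L y \<longleftrightarrow> x = (x \<leadsto> y\<^sup>\<star>)\<^sup>\<star>"

end

locale involutive_BE_algebra = bounded_BE_algebra +
  assumes involutive: "x \<in> X \<Longrightarrow> x\<^sup>\<star>\<^sup>\<star> = x"

locale implicative_BE_algebra = BE_algebra +
  assumes implicative: "\<lbrakk>x \<in> X; y \<in> X\<rbrakk> \<Longrightarrow> (x \<leadsto> y) \<leadsto> x = x"

locale implicative_ortholattice = involutive_BE_algebra + implicative_BE_algebra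

locale implicative_orthomodular_lattice = implicative_ortholattice +
  assumes orthomodular: "\<lbrakk>x \<in> X; y \<in> X\<rbrakk> \<Longrightarrow> x \<sqinter>\<^sub>Q (y \<leadsto> x) = x"

locale implicative_Boolean_algebra = implicative_ortholattice +
  assumes Boolean: "\<lbrakk>x \<in> X; y \<in> X\<rbrakk> \<Longrightarrow> (y\<^sup>\<star> \<leadsto> x) \<leadsto> y = x \<leadsto> y"

end

theory Submission
  imports Defs
begin

text \<open>
  An implicative-ortholattice is an ortholattice in disguise: its join is \<open>x\<^sup>\<star> \<leadsto> y\<close>, its meet is
  \<open>(x \<leadsto> y\<^sup>\<star>)\<^sup>\<star>\<close>, and \<open>\<preceq>\<^sub>L\<close> is the lattice order (\<open>le_L_iff_join\<close>). In these terms
  \<open>x \<squnion>\<^sub>Q y\<close> is the Sasaki expression \<open>(x \<and> y\<^sup>\<star>) \<or> y\<close>. It always lies below \<open>x \<or> y\<close> and above \<open>y\<close>,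
  so it lies above \<open>x\<close> as well exactly when it equals \<open>x \<or> y\<close>
  (\<open>le_join_Q_iff\<close>). On the other hand, the Boolean identity, read with
  \<open>x\<^sup>\<star>\<close> in place of \<open>x\<close>, says precisely that \<open>(x \<and> y\<^sup>\<star>) \<or> y = x \<or> y\<close> for all \<open>x, y\<close>
  (\<open>Boolean_iff_join_Q\<close>). This gives the equivalence of (a) and (c).
  Conditions (b) and (c) are De Morgan duals of each other, because \<open>\<sqinter>\<^sub>Q\<close> is the dual of \<open>\<squnion>\<^sub>Q\<close>
  and \<open>\<^sup>\<star>\<close> reverses \<open>\<preceq>\<^sub>L\<close>.
\<close>

context bounded_BE_algebra
begin

lemma star_closed: "x \<in> X \<Longrightarrow> x\<^sup>\<star> \<in> X"
  by (simp add: star_def imp_closed zero_closed)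

lemma join_Q_closed: "x \<in> X \<Longrightarrow> y \<in> X \<Longrightarrow> x \<squnion>\<^sub>Q y \<in> X"
  by (simp add: join_Q_def imp_closed)

text \<open>This is the exchange law with \<open>\<zero>\<close> as the last argument.\<close>

lemma imp_star_commute: "x \<in> X \<Longrightarrow> y \<in> X \<Longrightarrow> x \<leadsto> y\<^sup>\<star> = y \<leadsto> x\<^sup>\<star>"
  by (simp add: star_def exchange zero_closed)

end

context involutive_BE_algebra
begin

lemma contraposition: "x \<in> X \<Longrightarrow> y \<in> X \<Longrightarrow> y\<^sup>\<star> \<leadsto> x\<^sup>\<star> = x \<leadsto> y"
  using imp_star_commute[of x "y\<^sup>\<star>"] by (simp add: star_closed involutive)

lemma star_imp_commute: "x \<in> X \<Longrightarrow> y \<in> X \<Longrightarrow> x\<^sup>\<star> \<leadsto> y = y\<^sup>\<star> \<leadsto> x"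
  using contraposition[of "x\<^sup>\<star>" y] by (simp add: star_closed involutive)

lemma le_L_iff_star: 
  assumes "x \<in> X" "y \<in> X"
  shows "x \<preceq>\<^sub>L y \<longleftrightarrow> x \<leadsto> y\<^sup>\<star> = x\<^sup>\<star>"
  unfolding le_L_def using assms by (metis imp_closed involutive star_closed)

lemma star_le_L_star_iff:
  assumes "x \<in> X" "y \<in> X"
  shows "y\<^sup>\<star> \<preceq>\<^sub>L x\<^sup>\<star> \<longleftrightarrow> x\<^sup>\<star> \<leadsto> y = y"
  using assms by (simp add: le_L_iff_star star_closed involutive star_imp_commute)

lemma meet_Q_eq_star_join_Q: "x \<sqinter>\<^sub>Q y = (x\<^sup>\<star> \<squnion>\<^sub>Q y\<^sup>\<star>)\<^sup>\<star>"
  by (simp add: meet_Q_def join_Q_def)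

end

context implicative_ortholattice
begin

text \<open>
  The definition of \<open>\<preceq>\<^sub>L\<close> says that \<open>x\<close> is the meet of \<open>x\<close> and \<open>y\<close>; the implicative law plays the
  role of both absorption laws and turns this into the statement that \<open>y\<close> is their join.
\<close>

lemma le_L_iff_join:
  assumes x: "x \<in> X" and y: "y \<in> X"
  shows "x \<preceq>\<^sub>L y \<longleftrightarrow> x\<^sup>\<star> \<leadsto> y = y"
proof
  assume "x \<preceq>\<^sub>L y"
  then have "x\<^sup>\<star> = y \<leadsto> x\<^sup>\<star>"
    using x y by (simp add: le_L_iff_star imp_star_commute)
  then show "x\<^sup>\<star> \<leadsto> y = y"
    using implicative[OF y star_closed[OF x]] by simp
next
  assume "x\<^sup>\<star> \<leadsto> y = y"
  then have "y \<leadsto> x\<^sup>\<star> = x\<^sup>\<star>"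
    using implicative[OF star_closed[OF x] y] by simp
  then show "x \<preceq>\<^sub>L y"
    using x y by (simp add: le_L_iff_star imp_star_commute)
qed

lemma le_L_star_antitone:
  assumes "x \<in> X" "y \<in> X"
  shows "y\<^sup>\<star> \<preceq>\<^sub>L x\<^sup>\<star> \<longleftrightarrow> x \<preceq>\<^sub>L y"
  using assms by (simp add: star_le_L_star_iff le_L_iff_join)

text \<open>
  In lattice terms, \<open>x \<or> ((x \<and> y\<^sup>\<star>) \<or> y) = x \<or> y\<close>, since the term \<open>x \<and> y\<^sup>\<star>\<close> is absorbed by \<open>x\<close>.
\<close>

lemma join_with_join_Q:
  assumes x: "x \<in> X" and y: "y \<in> X"
  shows "x\<^sup>\<star> \<leadsto> (x \<squnion>\<^sub>Q y) = x\<^sup>\<star> \<leadsto> y"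
proof -
  have xy: "x \<leadsto> y \<in> X"
    using x y by (rule imp_closed)
  have "x\<^sup>\<star> \<leadsto> (x \<squnion>\<^sub>Q y) = (x \<leadsto> y) \<leadsto> (x\<^sup>\<star> \<leadsto> y)"
    unfolding join_Q_def using x y xy by (simp add: exchange star_closed)
  also have "\<dots> = (x \<leadsto> y) \<leadsto> (y\<^sup>\<star> \<leadsto> x)"
    using x y by (simp only: star_imp_commute)
  also have "\<dots> = y\<^sup>\<star> \<leadsto> ((x \<leadsto> y) \<leadsto> x)"
    using x y xy by (simp only: exchange star_closed)
  also have "\<dots> = x\<^sup>\<star> \<leadsto> y"
    using x y by (simp only: implicative star_imp_commute)
  finally show ?thesis .
qed

lemma le_join_Q_iff:
  assumes "x \<in> X" "y \<in> X"
  shows "x \<preceq>\<^sub>L x \<squnion>\<^sub>Q y \<longleftrightarrow> x \<squnion>\<^sub>Q y = x\<^sup>\<star> \<leadsto> y"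
  using assms by (auto simp: le_L_iff_join join_Q_closed join_with_join_Q)

text \<open>
  By contraposition the left side of the Boolean identity is \<open>x\<^sup>\<star> \<squnion>\<^sub>Q y\<close>, and its right side is the
  lattice join of \<open>x\<^sup>\<star>\<close> and \<open>y\<close>; by involutivity \<open>x\<^sup>\<star>\<close> ranges over all of \<open>X\<close>.
\<close>

lemma Boolean_iff_join_Q:
  "implicative_Boolean_algebra X imp \<one> \<zero> \<longleftrightarrow> (\<forall>x\<in>X. \<forall>y\<in>X. x \<squnion>\<^sub>Q y = x\<^sup>\<star> \<leadsto> y)"
proof -
  have "implicative_Boolean_algebra X imp \<one> \<zero>
      \<longleftrightarrow> (\<forall>x\<in>X. \<forall>y\<in>X. (y\<^sup>\<star> \<leadsto> x) \<leadsto> y = x \<leadsto> y)"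
    using implicative_ortholattice_axioms
    by (auto simp: implicative_Boolean_algebra_def implicative_Boolean_algebra_axioms_def)
  also have "\<dots> \<longleftrightarrow> (\<forall>x\<in>X. \<forall>y\<in>X. x\<^sup>\<star> \<squnion>\<^sub>Q y = x\<^sup>\<star>\<^sup>\<star> \<leadsto> y)"
    by (simp add: join_Q_def involutive star_imp_commute)
  also have "\<dots> \<longleftrightarrow> (\<forall>x\<in>X. \<forall>y\<in>X. x \<squnion>\<^sub>Q y = x\<^sup>\<star> \<leadsto> y)"
    by (metis involutive star_closed)
  finally show ?thesis .
qed

lemma Boolean_iff_le_join_Q:
  "implicative_Boolean_algebra X imp \<one> \<zero> \<longleftrightarrow> (\<forall>x\<in>X. \<forall>y\<in>X. x \<preceq>\<^sub>L x \<squnion>\<^sub>Q y)"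
  by (simp add: Boolean_iff_join_Q le_join_Q_iff)

lemma meet_Q_le_iff_le_join_Q:
  "(\<forall>x\<in>X. \<forall>y\<in>X. x \<sqinter>\<^sub>Q y \<preceq>\<^sub>L x) \<longleftrightarrow> (\<forall>x\<in>X. \<forall>y\<in>X. x \<preceq>\<^sub>L x \<squnion>\<^sub>Q y)"
proof -
  have dual: "x \<sqinter>\<^sub>Q y \<preceq>\<^sub>L x \<longleftrightarrow> x\<^sup>\<star> \<preceq>\<^sub>L x\<^sup>\<star> \<squnion>\<^sub>Q y\<^sup>\<star>" if "x \<in> X" "y \<in> X" for x y
    using le_L_star_antitone[of "x\<^sup>\<star>" "x\<^sup>\<star> \<squnion>\<^sub>Q y\<^sup>\<star>"] that
    by (simp add: meet_Q_eq_star_join_Q star_closed join_Q_closed involutive)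
  show ?thesis
    using dual by (metis involutive star_closed)
qed

end

theorem theorem5p7:
  fixes X :: "'a set"
    and imp :: "'a \<Rightarrow> 'a \<Rightarrow> 'a"
    and one zero :: 'a
  assumes "implicative_orthomodular_lattice X imp one zero"
  shows "(implicative_Boolean_algebra X imp one zero \<longleftrightarrow>
            (\<forall>x\<in>X. \<forall>y\<in>X. bounded_BE_algebra.le_L imp zero
                            (bounded_BE_algebra.meet_Q imp zero x y) x))
       \<and> (implicative_Boolean_algebra X imp one zero \<longleftrightarrow>
            (\<forall>x\<in>X. \<forall>y\<in>X. bounded_BE_algebra.le_L imp zero
                            x (bounded_BE_algebra.join_Q imp x y)))"
proof -
  interpret implicative_orthomodular_lattice X imp one zero
    by (fact assms)
  show ?thesis
    by (simp only: meet_Q_le_iff_le_join_Q Boolean_iff_le_join_Q)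
qed

end
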